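(* Let $X$ be a Dedekind complete weakly $\sigma$-distributive Riesz space, let $\mathbb{T}$ be a time scale and let $a,b\in\mathbb{T}$ with $a<b$. Let $\{f_n\}_{n=1}^{\infty}$ be a sequence of HK $\Delta$-integrable functions $f_n:[a,b]_{\mathbb{T}}\to X$ such that $f_1$ is (order) bounded from below, and let $f:[a,b]_{\mathbb{T}}\to X$ be an (order) bounded function. Assume that $f_n\le f_{n+1}$ pointwise on $[a,b]_{\mathbb{T}}$ for all $n\in\mathbb{N}$ and that $f_n\to f$ with a common regulating sequence. Then $f$ is HK $\Delta$-integrable on $[a,b]_{\mathbb{T}}$ and $$\lim_{n\to\infty}\int_a^b f_n(t)\,\Delta t=\int_a^b f(t)\,\Delta t .$$
   Context: Riesz spaces. A sequence $(b_n)_n$ in a Riesz space $X$ is an $(o)$-sequence if it is decreasing and $\bigwedge_n b_n=0$. An (order) bounded double sequence $(a_{i,j})_{i,j\in\mathbb{N}}$ in $X$ is a $(D)$-sequence (regulator) if for every $i\in\mathbb{N}$ the sequence $(a_{i,j})_{j}$ is an $(o)$-sequence. $X$ is Dedekind complete if every nonempty subset bounded from above has a supremum. A Dedekind complete $X$ is weakly $\sigma$-distributive if $\bigwedge_{\varphi\in\mathbb{N}^{\mathbb{N}}}\big(\bigvee_{i=1}^{\infty}a_{i,\varphi(i)}\big)=0$ for every $(D)$-sequence $(a_{i,j})_{i,j}$. In $X$, $u<v$ means $u\le v$ and $u\neq v$. A function $g:[a,b]_{\mathbb{T}}\to X$ is bounded from below if there is $l\in X$ with $l\le g(t)$ for all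 $t$, and bounded if there are $l,L\in X$ with $l\le g(t)\le L$ for all $t$. Time scales. A time scale $\mathbb{T}$ is a nonempty closed subset of $\mathbb{R}$; $[a,b]_{\mathbb{T}}=\{t\in\mathbb{T}:a\le t\le b\}$, and similarly for the other types of intervals. $\sigma(t)=\inf\{s\in\mathbb{T}:s>t\}$ (with $\inf\emptyset=\sup\mathbb{T}$) and $\mu(t)=\sigma(t)-t$. Gauges and partitions. A $\Delta$-gauge for $[a,b]_{\mathbb{T}}$ is a pair $\delta=(\delta_L,\delta_R)$ of real-valued functions on $[a,b]_{\mathbb{T}}$ with $\delta_L>0$ on $(a,b]_{\mathbb{T}}$, $\delta_R>0$ on $[a,b)_{\mathbb{T}}$, $\delta_L(a)\ge 0$, $\delta_R(b)\ge 0$, and $\delta_R(\xi)\ge\mu(\xi)$ for all $\xi\in[a,b)_{\mathbb{T}}$. A $\delta$-fine HK partition of $[a,b]_{\mathbb{T}}$ is a finite collection $\mathcal{D}=\{([t_{i-1},t_i]_{\mathbb{T}},\xi_i)\}_{i=1}^n$ with $t_i\in\mathbb{T}$, $a=t_0<t_1<\dots<t_n=b$, and $\xi_i\in[t_{i-1},t_i]_{\mathbb{T}}\subset[\xi_i-\delta_L(\xi_i),\xi_i+\delta_R(\xi_i)]$ for all $i$. For $f:[a,b]_{\mathbb{T}}\to X$ put $S(f,\mathcal{D},\delta)=\sum_{i=1}^n f(\xi_i)(t_i-t_{i-1})$. Integral. $f:[a,b]_{\mathbb{T}}\to X$ is HK $\Delta$-integrable on $[a,b]_{\mathbb{T}}$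 if there exist $x\in X$ and a $(D)$-sequence $(a_{i,j})_{i,j}$ in $X$ such that for every $\varphi\in\mathbb{N}^{\mathbb{N}}$ there is a $\Delta$-gauge $\delta$ for $[a,b]_{\mathbb{T}}$ with $|S(f,\mathcal{D},\delta)-x|<\bigvee_{i=1}^{\infty}a_{i,\varphi(i)}$ for each $\delta$-fine HK partition $\mathcal{D}$ of $[a,b]_{\mathbb{T}}$. Such $x$ is unique and is denoted $\int_a^b f(t)\,\Delta t$. Convergence with a common regulating sequence. $f_n\to f$ with a common regulating sequence if there is a $(D)$-sequence $(a_{i,j})_{i,j}$ in $X$ such that for every $\varphi\in\mathbb{N}^{\mathbb{N}}$ and every $t\in[a,b]_{\mathbb{T}}$ there is $p=p(t)\in\mathbb{N}$ (possibly depending on $\varphi$) such that $|f_n(t)-f(t)|<\bigvee_{i=1}^{\infty}a_{i,\varphi(i)}$ for all $n\ge p$. Limits in $X$. $\lim_{n\to\infty}x_n=x$ means: there is a $(D)$-sequence $(d_{i,j})_{i,j}$ in $X$ such that for every $\varphi\in\mathbb{N}^{\mathbb{N}}$ there is $n_0\in\mathbb{N}$ with $|x_n-x|\le\bigvee_{i=1}^{\infty}d_{i,\varphi(i)}$ for all $n\ge n_0$. *)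

theory Defs
  imports "HOL-Analysis.Analysis" "HOL-Library.Lattice_Algebras"
begin

section \<open>Riesz spaces\<close>

text \<open>The class \<open>lattice_ab_group_add_abs\<close> supplies \<open>\<bar>x\<bar> = sup x (- x)\<close>.  For these partial orders
  \<open>u < v\<close> means \<open>u \<le> v\<close> and \<open>u \<noteq> v\<close>.\<close>

class riesz_space = ordered_real_vector + lattice_ab_group_add_abs

class dedekind_complete_riesz_space = riesz_space + conditionally_complete_lattice

instance real :: dedekind_complete_riesz_space ..

text \<open>\<open>Inf\<close> is unspecified on sets that are not bounded below, hence the explicit \<open>bdd_below\<close>.\<close>

definition o_sequence :: "(nat \<Rightarrow> 'x::dedekind_complete_riesz_space) \<Rightarrow> bool" where
  "o_sequence b \<longleftrightarrow> antimono b \<and> bdd_below (range b) \<and> (INF n. b n) = 0"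

definition D_sequence :: "(nat \<Rightarrow> nat \<Rightarrow> 'x::dedekind_complete_riesz_space) \<Rightarrow> bool" where
  "D_sequence a \<longleftrightarrow>
     (\<exists>l u. \<forall>i j. l \<le> a i j \<and> a i j \<le> u) \<and> (\<forall>i. o_sequence (a i))"

text \<open>For a \<open>D_sequence\<close>, the suprema below are taken over order bounded sets, and all of them are
  nonnegative; so both \<open>SUP\<close> and \<open>INF\<close> are genuine.\<close>

definition weakly_sigma_distributive :: "'x::dedekind_complete_riesz_space itself \<Rightarrow> bool" where
  "weakly_sigma_distributive _ \<longleftrightarrow>
     (\<forall>a :: nat \<Rightarrow> nat \<Rightarrow> 'x. D_sequence a \<longrightarrow> (INF \<phi>::nat \<Rightarrow> nat. SUP i. a i (\<phi> i)) = 0)"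

definition D_convergent_to :: "(nat \<Rightarrow> 'x::dedekind_complete_riesz_space) \<Rightarrow> 'x \<Rightarrow> bool" where
  "D_convergent_to x l \<longleftrightarrow>
     (\<exists>d. D_sequence d \<and>
        (\<forall>\<phi>::nat \<Rightarrow> nat. \<exists>n\<^sub>0. \<forall>n\<ge>n\<^sub>0. \<bar>x n - l\<bar> \<le> (SUP i. d i (\<phi> i))))"

definition converges_common_regulator ::
  "'t set \<Rightarrow> (nat \<Rightarrow> 't \<Rightarrow> 'x::dedekind_complete_riesz_space) \<Rightarrow> ('t \<Rightarrow> 'x) \<Rightarrow> bool" where
  "converges_common_regulator I f g \<longleftrightarrow>
     (\<exists>a. D_sequence a \<and>
        (\<forall>\<phi>::nat \<Rightarrow> nat. \<forall>t\<in>I. \<exists>p. \<forall>n\<ge>p. \<bar>f n t - g t\<bar> < (SUP i. a i (\<phi> i))))"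

section \<open>Time scales\<close>

definition time_scale :: "real set \<Rightarrow> bool" where
  "time_scale T \<longleftrightarrow> T \<noteq> {} \<and> closed T"

definition forward_jump :: "real set \<Rightarrow> real \<Rightarrow> real" where
  "forward_jump T t = (if {s\<in>T. s > t} = {} then Sup T else Inf {s\<in>T. s > t})"

definition graininess :: "real set \<Rightarrow> real \<Rightarrow> real" where
  "graininess T t = forward_jump T t - t"

section \<open>The Henstock-Kurzweil delta integral\<close>

text \<open>Functions on \<open>{a..b} \<inter> T\<close> are represented by total functions on the reals, of which only the
  values on \<open>{a..b} \<inter> T\<close> are ever used.\<close>

definition delta_gauge ::
  "real set \<Rightarrow> real \<Rightarrow> real \<Rightarrow> (real \<Rightarrow> real) \<times> (real \<Rightarrow> real) \<Rightarrow> bool" where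
  "delta_gauge T a b = (\<lambda>(\<delta>L, \<delta>R).
     (\<forall>\<xi>\<in>{a<..b} \<inter> T. \<delta>L \<xi> > 0) \<and>
     (\<forall>\<xi>\<in>{a..<b} \<inter> T. \<delta>R \<xi> > 0) \<and>
     \<delta>L a \<ge> 0 \<and> \<delta>R b \<ge> 0 \<and>
     (\<forall>\<xi>\<in>{a..<b} \<inter> T. \<delta>R \<xi> \<ge> graininess T \<xi>))"

text \<open>A partition is given by \<open>n\<close>, its division points \<open>t 0, \<dots>, t n\<close> and its tags \<open>\<xi> 1, \<dots>, \<xi> n\<close>.\<close>

definition fine_HK_partition ::
  "real set \<Rightarrow> real \<Rightarrow> real \<Rightarrow> (real \<Rightarrow> real) \<times> (real \<Rightarrow> real) \<Rightarrow>
   nat \<Rightarrow> (nat \<Rightarrow> real) \<Rightarrow> (nat \<Rightarrow> real) \<Rightarrow> bool" where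
  "fine_HK_partition T a b = (\<lambda>(\<delta>L, \<delta>R) n t \<xi>.
     t 0 = a \<and> t n = b \<and>
     (\<forall>i\<in>{0..n}. t i \<in> T) \<and>
     (\<forall>i\<in>{1..n}.
        t (i - 1) < t i \<and>
        \<xi> i \<in> {t (i - 1)..t i} \<inter> T \<and>
        {t (i - 1)..t i} \<inter> T \<subseteq> {\<xi> i - \<delta>L (\<xi> i)..\<xi> i + \<delta>R (\<xi> i)}))"

definition HK_sum ::
  "(real \<Rightarrow> 'x::real_vector) \<Rightarrow> nat \<Rightarrow> (nat \<Rightarrow> real) \<Rightarrow> (nat \<Rightarrow> real) \<Rightarrow> 'x" where
  "HK_sum f n t \<xi> = (\<Sum>i=1..n. (t i - t (i - 1)) *\<^sub>R f (\<xi> i))"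

definition has_HK_delta_integral ::
  "real set \<Rightarrow> real \<Rightarrow> real \<Rightarrow> (real \<Rightarrow> 'x::dedekind_complete_riesz_space) \<Rightarrow> 'x \<Rightarrow> bool" where
  "has_HK_delta_integral T a b f x \<longleftrightarrow>
     (\<exists>r. D_sequence r \<and>
        (\<forall>\<phi>::nat \<Rightarrow> nat. \<exists>\<delta>. delta_gauge T a b \<delta> \<and>
           (\<forall>n t \<xi>. fine_HK_partition T a b \<delta> n t \<xi> \<longrightarrow>
              \<bar>HK_sum f n t \<xi> - x\<bar> < (SUP i. r i (\<phi> i)))))"

definition HK_delta_integrable ::
  "real set \<Rightarrow> real \<Rightarrow> real \<Rightarrow> (real \<Rightarrow> 'x::dedekind_complete_riesz_space) \<Rightarrow> bool" where
  "HK_delta_integrable T a b f \<longleftrightarrow> (\<exists>x. has_HK_delta_integral T a b f x)"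

definition HK_delta_integral ::
  "real set \<Rightarrow> real \<Rightarrow> real \<Rightarrow> (real \<Rightarrow> 'x::dedekind_complete_riesz_space) \<Rightarrow> 'x" where
  "HK_delta_integral T a b f = (THE x. has_HK_delta_integral T a b f x)"

end

theory Submission
  imports Defs
begin

text \<open>The integrals \<open>x n\<close> of \<open>f n\<close> increase to a supremum \<open>X\<close>. Given \<open>\<phi>\<close>, assign to every point
  \<open>\<xi>\<close> a level \<open>\<nu> \<xi> \<ge> \<phi> 1\<close> from which on \<open>f n \<xi>\<close> is close to \<open>g \<xi>\<close>, and give \<open>\<xi>\<close> the gauge that
  belongs to \<open>f (\<nu> \<xi>)\<close>. On a fine partition the Riemann sum of \<open>g\<close> is close to the sum of the
  terms \<open>f (\<nu> \<xi>) \<xi>\<close>, which by an argument in the style of Henstock's lemma lies between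
  \<open>x (\<phi> 1)\<close> and \<open>X\<close> up to a multiple of the sum of the errors of the single levels. Since \<open>g\<close> is
  bounded, Fremlin's lemma turns the countably many regulators into one.\<close>

section \<open>Order sequences and regulators\<close>

text \<open>Greatest lower bounds stated elementwise spare the later proofs the
  \<open>bdd_below\<close> conditions that accompany \<open>Inf\<close>.\<close>

lemma o_sequence_iff:
  fixes b :: "nat \<Rightarrow> 'x::dedekind_complete_riesz_space"
  shows "o_sequence b \<longleftrightarrow> antimono b \<and> (\<forall>j. 0 \<le> b j) \<and> (\<forall>z. (\<forall>j. z \<le> b j) \<longrightarrow> z \<le> 0)"
proof
  assume b: "o_sequence b"
  then have bdd: "bdd_below (range b)" and inf: "(INF n. b n) = 0" and "antimono b"
    by (auto simp: o_sequence_def)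
  moreover have "0 \<le> b j" for j
    using cINF_lower[OF bdd, of j] inf by simp
  moreover have "z \<le> 0" if "\<forall>j. z \<le> b j" for z
    using cINF_greatest[of UNIV z b] that inf by simp
  ultimately show "antimono b \<and> (\<forall>j. 0 \<le> b j) \<and> (\<forall>z. (\<forall>j. z \<le> b j) \<longrightarrow> z \<le> 0)" by blast
next
  assume b: "antimono b \<and> (\<forall>j. 0 \<le> b j) \<and> (\<forall>z. (\<forall>j. z \<le> b j) \<longrightarrow> z \<le> 0)"
  have bdd: "bdd_below (range b)"
    using b by (intro bdd_belowI[of _ 0]) auto
  have "(INF n. b n) \<le> 0"
    using b cINF_lower[OF bdd] by blast
  moreover have "0 \<le> (INF n. b n)"
    using b by (intro cINF_greatest) auto
  ultimately show "o_sequence b"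
    using b bdd by (auto simp: o_sequence_def)
qed

lemma o_sequence_zero: "o_sequence (\<lambda>_. 0)"
  by (auto simp: o_sequence_iff antimono_def)

lemma o_sequence_add:
  assumes "o_sequence b" "o_sequence c"
  shows "o_sequence (\<lambda>j. b j + c j)"
  unfolding o_sequence_iff
proof (intro conjI allI impI)
  show "antimono (\<lambda>j. b j + c j)"
    using assms by (auto simp: o_sequence_iff antimono_def intro: add_mono)
  show "0 \<le> b j + c j" for j
    using assms by (auto simp: o_sequence_iff)
  fix z assume z: "\<forall>j. z \<le> b j + c j"
  \<comment> \<open>The two sequences are first decoupled: passing to \<open>max j k\<close> bounds
    \<open>z\<close> by terms with independent indices, so that the infima can be taken one after
    the other.\<close>
  have "z - c k \<le> b j" for j k
  proof -
    have "z \<le> b (max j k) + c (max j k)" using z by blast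
    also have "\<dots> \<le> b j + c k"
      using assms by (intro add_mono) (auto simp: o_sequence_iff antimono_def)
    finally show ?thesis by (simp add: algebra_simps)
  qed
  then have "z - c k \<le> 0" for k
    using assms(1) unfolding o_sequence_iff by blast
  then show "z \<le> 0"
    using assms(2) by (auto simp: o_sequence_iff)
qed

lemma o_sequence_sum:
  assumes "\<And>i. i \<in> I \<Longrightarrow> o_sequence (b i)"
  shows "o_sequence (\<lambda>j. \<Sum>i\<in>I. b i j)"
  using assms
  by (induction I rule: infinite_finite_induct) (auto intro: o_sequence_zero o_sequence_add)

lemma o_sequence_dominated:
  assumes "o_sequence b" "antimono c" "\<And>j. 0 \<le> c j" "\<And>j. c j \<le> b j"
  shows "o_sequence c"
  using assms unfolding o_sequence_iff by (blast intro: order_trans)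

lemma o_sequence_scaleR:
  fixes b :: "nat \<Rightarrow> 'x::dedekind_complete_riesz_space"
  assumes "o_sequence b" "0 \<le> k"
  shows "o_sequence (\<lambda>j. k *\<^sub>R b j)"
proof (cases "k = 0")
  case False
  then have k: "k > 0" using assms(2) by simp
  show ?thesis
    unfolding o_sequence_iff
  proof (intro conjI allI impI)
    show "antimono (\<lambda>j. k *\<^sub>R b j)"
      using assms by (auto simp: o_sequence_iff antimono_def intro: scaleR_left_mono)
    show "0 \<le> k *\<^sub>R b j" for j
      using assms by (auto simp: o_sequence_iff intro: scaleR_nonneg_nonneg)
    fix z assume "\<forall>j. z \<le> k *\<^sub>R b j"
    then have "\<forall>j. (1 / k) *\<^sub>R z \<le> b j"
      using k scaleR_left_mono[of z _ "1 / k"] by fastforce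
    then have "(1 / k) *\<^sub>R z \<le> 0"
      using assms(1) by (auto simp: o_sequence_iff)
    from scaleR_left_mono[OF this, of k] show "z \<le> 0"
      using k by simp
  qed
qed (simp add: o_sequence_zero)

text \<open>The infimum is zero because a Dedekind complete Riesz space is Archimedean.\<close>

lemma o_sequence_inverse:
  fixes e :: "'x::dedekind_complete_riesz_space"
  assumes "0 \<le> e"
  shows "o_sequence (\<lambda>j. (1 / real (Suc j)) *\<^sub>R e)"
  unfolding o_sequence_iff
proof (intro conjI allI impI)
  show "antimono (\<lambda>j. (1 / real (Suc j)) *\<^sub>R e)"
    using assms by (auto simp: antimono_def intro!: scaleR_right_mono frac_le)
  show "0 \<le> (1 / real (Suc j)) *\<^sub>R e" for j
    using assms by (intro scaleR_nonneg_nonneg) auto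
  fix z assume z: "\<forall>j. z \<le> (1 / real (Suc j)) *\<^sub>R e"
  have mult: "real (Suc j) *\<^sub>R z \<le> e" for j
    using scaleR_left_mono[OF z[rule_format, of j], of "real (Suc j)"] by simp
  \<comment> \<open>All multiples of \<open>z\<close> lie below \<open>e\<close>, so their supremum
    \<open>s\<close> exists. The multiple with the next index adds another \<open>z\<close> and
    still lies below \<open>s\<close>, so \<open>s - z\<close> is an upper bound as well.\<close>
  define s where "s = (SUP j. real (Suc j) *\<^sub>R z)"
  have bdd: "bdd_above (range (\<lambda>j. real (Suc j) *\<^sub>R z))"
    using mult by (intro bdd_aboveI[of _ e]) auto
  have "real (Suc j) *\<^sub>R z \<le> s - z" for j
  proof -
    have "real (Suc (Suc j)) *\<^sub>R z \<le> s"
      unfolding s_def by (rule cSUP_upper[OF _ bdd]) simp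
    moreover have "real (Suc (Suc j)) *\<^sub>R z = real (Suc j) *\<^sub>R z + z"
      using scaleR_add_left[of "real (Suc j)" 1 z] by (simp add: add.commute)
    ultimately show ?thesis by (simp add: algebra_simps)
  qed
  then have "s \<le> s - z"
    unfolding s_def by (intro cSUP_least) auto
  then show "z \<le> 0" by simp
qed

section \<open>Operations on regulators and suprema along \<phi>\<close>

lemma D_sequenceI:
  assumes "\<And>i. o_sequence (a i)" "\<And>i j. a i j \<le> u"
  shows "D_sequence a"
  unfolding D_sequence_def using assms by (meson o_sequence_iff)

lemma D_sequence_nonneg: "D_sequence a \<Longrightarrow> 0 \<le> a i j"
  by (auto simp: D_sequence_def o_sequence_iff)

lemma D_sequence_bdd: "D_sequence a \<Longrightarrow> bdd_above (range (\<lambda>i. a i (\<phi> i)))"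
  unfolding D_sequence_def by (auto simp: bdd_above_def)

lemma D_sequence_upper: "D_sequence a \<Longrightarrow> a i (\<phi> i) \<le> (SUP i. a i (\<phi> i))"
  by (intro cSUP_upper D_sequence_bdd) auto

lemma D_sequence_SUP_nonneg: "D_sequence a \<Longrightarrow> 0 \<le> (SUP i. a i (\<phi> i))"
  using D_sequence_upper D_sequence_nonneg order_trans by blast

lemma D_sequence_add:
  assumes "D_sequence a" "D_sequence b"
  shows "D_sequence (\<lambda>i j. a i j + b i j)"
proof -
  obtain u v where "\<And>i j. a i j \<le> u" "\<And>i j. b i j \<le> v"
    using assms unfolding D_sequence_def by blast
  then show ?thesis
    using assms by (intro D_sequenceI[of _ "u + v"] o_sequence_add add_mono)
      (auto simp: D_sequence_def)
qed

lemma D_sequence_scaleR: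
  assumes "D_sequence a" "0 \<le> k"
  shows "D_sequence (\<lambda>i j. k *\<^sub>R a i j)"
proof -
  obtain u where "\<And>i j. a i j \<le> u"
    using assms unfolding D_sequence_def by blast
  then show ?thesis
    using assms by (intro D_sequenceI[of _ "k *\<^sub>R u"] o_sequence_scaleR scaleR_left_mono)
      (auto simp: D_sequence_def)
qed

text \<open>Embeds a single order sequence among the regulators. Row 0 alone shows that the supremum
  along \<phi> dominates \<open>c (\<phi> 0)\<close>.\<close>

lemma D_sequence_row: "o_sequence c \<Longrightarrow> D_sequence (\<lambda>i::nat. c)"
  by (rule D_sequenceI[of _ "c 0"]) (auto simp: o_sequence_iff antimono_def)

lemma scaleR_SUP_le:
  assumes "D_sequence a" "0 \<le> k"
  shows "k *\<^sub>R (SUP i. a i (\<phi> i)) \<le> (SUP i. k *\<^sub>R a i (\<phi> i))"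
proof (cases "k = 0")
  case False
  then have k: "k > 0" using assms(2) by simp
  have "a i (\<phi> i) \<le> (1 / k) *\<^sub>R (SUP i. k *\<^sub>R a i (\<phi> i))" for i
  proof -
    have "k *\<^sub>R a i (\<phi> i) \<le> (SUP i. k *\<^sub>R a i (\<phi> i))"
      using D_sequence_upper[OF D_sequence_scaleR[OF assms]] by blast
    from scaleR_left_mono[OF this, of "1 / k"] k show ?thesis by simp
  qed
  then have "(SUP i. a i (\<phi> i)) \<le> (1 / k) *\<^sub>R (SUP i. k *\<^sub>R a i (\<phi> i))"
    by (intro cSUP_least) auto
  from scaleR_left_mono[OF this, of k] k show ?thesis by simp
qed simp

section \<open>Vanishing of errors by weak sigma-distributivity\<close>

lemma weakly_sigma_distributive_le_zero:
  fixes y :: "'x::dedekind_complete_riesz_space"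
  assumes "weakly_sigma_distributive TYPE('x)" "D_sequence a"
    and "\<And>\<phi>. y \<le> (SUP i. a i (\<phi> i))"
  shows "y \<le> 0"
proof -
  have "y \<le> (INF \<phi>::nat \<Rightarrow> nat. SUP i. a i (\<phi> i))"
    using assms(3) by (intro cINF_greatest) auto
  then show ?thesis
    using assms(1,2) unfolding weakly_sigma_distributive_def by metis
qed

text \<open>The regulator \<open>2 *\<^sub>R (a i j + b i j)\<close> absorbs both errors: by
  nonnegativity each of the two suprema is at most that of the sum \<open>a + b\<close>, and the
  factor 2 pays for adding them.\<close>

lemma weakly_sigma_distributive_le_zero2:
  fixes y :: "'x::dedekind_complete_riesz_space"
  assumes "weakly_sigma_distributive TYPE('x)" and a: "D_sequence a" and b: "D_sequence b"
    and y: "\<And>\<phi>. y \<le> (SUP i. a i (\<phi> i)) + (SUP i. b i (\<phi> i))"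
  shows "y \<le> 0"
proof (rule weakly_sigma_distributive_le_zero[OF assms(1)])
  have ab: "D_sequence (\<lambda>i j. a i j + b i j)" by (rule D_sequence_add[OF a b])
  show "D_sequence (\<lambda>i j. 2 *\<^sub>R (a i j + b i j))"
    by (rule D_sequence_scaleR[OF ab]) simp
  fix \<phi>
  let ?s = "SUP i. a i (\<phi> i) + b i (\<phi> i)"
  have le: "a i (\<phi> i) + b i (\<phi> i) \<le> ?s" for i
    using D_sequence_upper[OF ab] by simp
  have "a i (\<phi> i) \<le> ?s" "b i (\<phi> i) \<le> ?s" for i
    using le[of i] D_sequence_nonneg[OF a] D_sequence_nonneg[OF b]
    by (meson add_increasing add_increasing2 order_refl order_trans)+
  then have "(SUP i. a i (\<phi> i)) \<le> ?s" "(SUP i. b i (\<phi> i)) \<le> ?s"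
    by (auto intro: cSUP_least)
  then have "y \<le> ?s + ?s"
    using y[of \<phi>] add_mono order_trans by blast
  also have "\<dots> = 2 *\<^sub>R ?s" by (simp add: scaleR_2)
  also have "\<dots> \<le> (SUP i. 2 *\<^sub>R (a i (\<phi> i) + b i (\<phi> i)))"
    using scaleR_SUP_le[OF ab, of 2 \<phi>] by simp
  finally show "y \<le> (SUP i. 2 *\<^sub>R (a i (\<phi> i) + b i (\<phi> i)))" .
qed

text \<open>Meets distribute over suprema in a Riesz space. The identity
  \<open>u + y = inf u y + sup u y\<close> turns a bound on the meet into a bound on
  \<open>y i\<close> that does not depend on \<open>i\<close>, and turns it back after the supremum
  has been taken.\<close>

lemma inf_SUP_le:
  fixes u :: "'x::dedekind_complete_riesz_space"
  assumes "I \<noteq> {}" and bdd: "bdd_above (y ` I)" and "\<And>i. i \<in> I \<Longrightarrow> inf u (y i) \<le> B"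
  shows "inf u (SUP i\<in>I. y i) \<le> B"
proof -
  let ?s = "SUP i\<in>I. y i"
  have "y i \<le> B + sup u ?s - u" if "i \<in> I" for i
  proof -
    have "y i \<le> ?s" using that by (intro cSUP_upper bdd)
    then have "inf u (y i) + sup u (y i) \<le> B + sup u ?s"
      using assms(3)[OF that] by (intro add_mono sup_mono) auto
    then show ?thesis
      using add_eq_inf_sup[of u "y i"] by (simp add: algebra_simps)
  qed
  then have "?s \<le> B + sup u ?s - u"
    using assms(1) by (intro cSUP_least) auto
  then show ?thesis
    using add_eq_inf_sup[of u ?s] by (simp add: algebra_simps)
qed

text \<open>Fremlin's lemma. The sum is dominated by a supremum because
  \<open>y n\<close> has weight \<open>1 / 2 ^ Suc n\<close> against \<open>2 ^ Suc n * y n\<close>, and the shift \<open>i + n\<close> leaves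
  only finitely many pairs \<open>(n, i)\<close> for each value of the index of \<open>\<phi>\<close>.\<close>

lemma Fremlin:
  fixes a :: "nat \<Rightarrow> nat \<Rightarrow> nat \<Rightarrow> 'x::dedekind_complete_riesz_space"
  assumes a: "\<And>n. D_sequence (a n)" and u: "0 \<le> u"
  obtains b where "D_sequence b"
    and "\<And>\<phi> q. inf u (\<Sum>n\<le>q. SUP i. a n i (\<phi> (i + n))) \<le> (SUP i. b i (\<phi> i))"
proof
  \<comment> \<open>\<open>c m\<close> gathers the pairs (n, i) with \<open>i + n = m\<close>; all
    of them are evaluated at the same argument \<open>\<phi> m\<close>.\<close>
  define c where "c m j = (\<Sum>n\<le>m. (2 ^ Suc n) *\<^sub>R a n (m - n) j)" for m j
  \<comment> \<open>The weights grow with \<open>m\<close>, so the rows \<open>c m\<close> need not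
    have a common bound; the meet with \<open>u\<close> provides one.\<close>
  define b where "b m j = inf u (c m j)" for m j
  have c: "o_sequence (c m)" for m
    unfolding c_def using a
    by (intro o_sequence_sum o_sequence_scaleR) (auto simp: D_sequence_def)
  then have c0: "0 \<le> c m j" for m j
    by (auto simp: o_sequence_iff)
  have "o_sequence (b m)" for m
  proof (rule o_sequence_dominated[OF c[of m]])
    show "antimono (b m)"
      using c[of m] unfolding b_def o_sequence_iff antimono_def by (meson inf_mono order_refl)
  qed (use u c0 in \<open>auto simp: b_def\<close>)
  then show b: "D_sequence b"
    by (rule D_sequenceI[of _ u]) (simp add: b_def)
  fix \<phi> :: "nat \<Rightarrow> nat" and q
  define y where "y n = (SUP i. a n i (\<phi> (i + n)))" for n
  define w where "w n i = (2 ^ Suc n) *\<^sub>R a n i (\<phi> (i + n))" for n i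
  let ?B = "SUP i. b i (\<phi> i)"
  have an: "D_sequence (\<lambda>i j. (2 ^ Suc n) *\<^sub>R a n i j)" for n
    by (rule D_sequence_scaleR[OF a]) simp
  have Y: "(2 ^ Suc n) *\<^sub>R y n \<le> (SUP i. w n i)" for n
    unfolding y_def w_def
    by (rule scaleR_SUP_le[OF a, of _ _ "\<lambda>i. \<phi> (i + n)"]) simp
  have wB: "inf u (w n i) \<le> ?B" for n i
  proof -
    have "w n i \<le> c (i + n) (\<phi> (i + n))"
      unfolding w_def c_def
      using sum_mono2[of "{..i + n}" "{n}" "\<lambda>k. (2 ^ Suc k) *\<^sub>R a k (i + n - k) (\<phi> (i + n))"]
        scaleR_nonneg_nonneg[OF _ D_sequence_nonneg[OF a]] by simp
    then have "inf u (w n i) \<le> b (i + n) (\<phi> (i + n))"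
      unfolding b_def by (intro inf_mono) auto
    also have "\<dots> \<le> ?B"
      by (rule D_sequence_upper[OF b])
    finally show ?thesis .
  qed
  have WB: "inf u (SUP i. w n i) \<le> ?B" for n
    unfolding w_def
    by (rule inf_SUP_le) (use D_sequence_bdd[OF an] wB in \<open>auto simp: w_def\<close>)
  have W0: "0 \<le> (SUP i. w n i)" for n
    using D_sequence_SUP_nonneg[OF an] unfolding w_def by simp
  let ?S = "SUP n\<in>{..q}. SUP i. w n i"
  have WS: "(SUP i. w n i) \<le> ?S" if "n \<le> q" for n
    using that by (intro cSUP_upper) auto
  have S0: "0 \<le> ?S"
    using WS[of 0] W0[of 0] order_trans by blast
  \<comment> \<open>\<open>?S\<close> bounds every \<open>2 ^ Suc n\<close> multiple of
    \<open>y n\<close>, so the weights that remain form a geometric sum of at most 1.\<close>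
  have "(\<Sum>n\<le>q. y n) \<le> (\<Sum>n\<le>q. (1 / 2 ^ Suc n) *\<^sub>R ?S)"
  proof (rule sum_mono)
    fix n assume "n \<in> {..q}"
    then have "(2 ^ Suc n) *\<^sub>R y n \<le> ?S"
      using Y[of n] WS[of n] order_trans by auto
    from scaleR_left_mono[OF this, of "1 / 2 ^ Suc n"]
    show "y n \<le> (1 / 2 ^ Suc n) *\<^sub>R ?S" by simp
  qed
  also have "\<dots> = (\<Sum>n\<le>q. 1 / 2 ^ Suc n) *\<^sub>R ?S"
    by (rule scaleR_left.sum[symmetric])
  also have "\<dots> \<le> 1 *\<^sub>R ?S"
  proof (rule scaleR_right_mono[OF _ S0])
    have "(\<Sum>n\<le>q. 1 / 2 ^ Suc n) = 1 - 1 / (2::real) ^ Suc q"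
      by (induction q) (auto simp: field_simps)
    then show "(\<Sum>n\<le>q. 1 / 2 ^ Suc n) \<le> (1::real)" by simp
  qed
  finally have "inf u (\<Sum>n\<le>q. y n) \<le> inf u ?S"
    by (intro inf_mono) auto
  also have "\<dots> \<le> ?B"
    \<comment> \<open>The meet passes through two suprema: over \<open>i\<close> in
      \<open>WB\<close>, and over the finitely many \<open>n\<close> here.\<close>
    by (rule inf_SUP_le) (auto intro: WB)
  finally show "inf u (\<Sum>n\<le>q. SUP i. a n i (\<phi> (i + n))) \<le> ?B"
    unfolding y_def .
qed

text \<open>The definition of the integral asks for strict inequalities; the summand
  \<open>e / (j + 1)\<close> handles the case where the regulator \<open>R\<close> vanishes along \<open>\<phi>\<close>, the factor 2 all others.\<close>

lemma strict_regulator: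
  fixes R :: "nat \<Rightarrow> nat \<Rightarrow> 'x::dedekind_complete_riesz_space"
    and e :: 'x
  assumes R: "D_sequence R" and e: "0 < e"
  obtains r where "D_sequence r"
    and "\<And>\<phi> y. y \<le> (SUP i. R i (\<phi> i)) \<Longrightarrow> y < (SUP i. r i (\<phi> i))"
proof
  define r where "r i j = 2 *\<^sub>R R i j + (1 / real (Suc j)) *\<^sub>R e" for i j
  have R2: "D_sequence (\<lambda>i j. 2 *\<^sub>R R i j)"
    by (rule D_sequence_scaleR[OF R]) simp
  have E: "o_sequence (\<lambda>j. (1 / real (Suc j)) *\<^sub>R e)"
    using e by (intro o_sequence_inverse) simp
  show r: "D_sequence r"
    unfolding r_def by (intro D_sequence_add R2 D_sequence_row E)
  fix \<phi> y
  let ?s = "SUP i. R i (\<phi> i)" and ?t = "SUP i. r i (\<phi> i)"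
  assume y: "y \<le> ?s"
  have s0: "0 \<le> ?s" by (rule D_sequence_SUP_nonneg[OF R])
  have rt: "r i (\<phi> i) \<le> ?t" for i
    by (rule D_sequence_upper[OF r])
  have "2 *\<^sub>R R i (\<phi> i) \<le> ?t" for i
  proof -
    have "2 *\<^sub>R R i (\<phi> i) \<le> r i (\<phi> i)"
      unfolding r_def using E by (simp add: o_sequence_iff)
    then show ?thesis using rt order_trans by blast
  qed
  then have "(SUP i. 2 *\<^sub>R R i (\<phi> i)) \<le> ?t"
    by (intro cSUP_least) auto
  then have st: "?s + ?s \<le> ?t"
    using scaleR_SUP_le[OF R, of 2 \<phi>] by (simp add: scaleR_2)
  have t0: "?t \<noteq> 0"
  proof
    assume "?t = 0"
    then have "r 0 (\<phi> 0) \<le> 0" using rt[of 0] by simp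
    moreover have "(1 / real (Suc (\<phi> 0))) *\<^sub>R e \<le> r 0 (\<phi> 0)"
      unfolding r_def using D_sequence_nonneg[OF R2] by simp
    ultimately have "(1 / real (Suc (\<phi> 0))) *\<^sub>R e \<le> 0" by (rule order_trans[rotated])
    from scaleR_left_mono[OF this, of "real (Suc (\<phi> 0))"] have "e \<le> 0" by simp
    with e show False by simp
  qed
  show "y < ?t"
  proof (rule order.not_eq_order_implies_strict)
    have "?s \<le> ?s + ?s" using s0 by simp
    then show yt: "y \<le> ?t" using y st order_trans by blast
    \<comment> \<open>Equality would give \<open>?s + ?s \<le> ?t = y \<le> ?s\<close>, hence
      \<open>?s = 0\<close> and then \<open>?t = 0\<close>, against \<open>t0\<close>.\<close>
    show "y \<noteq> ?t"
    proof
      assume "y = ?t"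
      then have "?s + ?s \<le> ?s" using y st order_trans by blast
      then have "?s = 0" using s0 by simp
      then have "?t \<le> 0" "0 \<le> ?t" using y \<open>y = ?t\<close> st by auto
      then show False using t0 by simp
    qed
  qed
qed

lemma abs_diff_leD:
  fixes x y e :: "'x::riesz_space"
  assumes "\<bar>y - x\<bar> \<le> e"
  shows "y \<le> x + e" "x \<le> y + e"
  using abs_le_D1[OF assms] abs_le_D2[OF assms] by (simp_all add: algebra_simps)

lemma abs_diff_leI:
  fixes x y e :: "'x::riesz_space"
  assumes "y \<le> x + e" "x \<le> y + e"
  shows "\<bar>y - x\<bar> \<le> e"
  using assms by (intro abs_leI) (simp_all add: algebra_simps)

section \<open>Fine partitions\<close>

lemma fine_HK_partition_iff:
  "fine_HK_partition T a b \<delta> n t \<xi> \<longleftrightarrow>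
     t 0 = a \<and> t n = b \<and> (\<forall>i\<in>{0..n}. t i \<in> T) \<and>
     (\<forall>i\<in>{1..n}. t (i - 1) < t i \<and> \<xi> i \<in> {t (i - 1)..t i} \<inter> T \<and>
        {t (i - 1)..t i} \<inter> T \<subseteq> {\<xi> i - fst \<delta> (\<xi> i)..\<xi> i + snd \<delta> (\<xi> i)})"
  by (cases \<delta>) (simp add: fine_HK_partition_def)

lemma delta_gauge_iff:
  "delta_gauge T a b \<delta> \<longleftrightarrow>
     (\<forall>\<xi>\<in>{a<..b} \<inter> T. fst \<delta> \<xi> > 0) \<and> (\<forall>\<xi>\<in>{a..<b} \<inter> T. snd \<delta> \<xi> > 0) \<and>
     fst \<delta> a \<ge> 0 \<and> snd \<delta> b \<ge> 0 \<and> (\<forall>\<xi>\<in>{a..<b} \<inter> T. snd \<delta> \<xi> \<ge> graininess T \<xi>)"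
  by (cases \<delta>) (simp add: delta_gauge_def)

lemma fine_HK_partition_mono:
  assumes "fine_HK_partition T a b \<delta> n t \<xi>" "i \<le> j" "j \<le> n"
  shows "t i \<le> t j"
  using assms(2,3)
proof (induction j rule: dec_induct)
  case (step j)
  have "\<forall>i\<in>{1..n}. t (i - 1) < t i"
    using assms(1) by (simp add: fine_HK_partition_iff)
  from bspec[OF this, of "Suc j"] step show ?case by simp
qed simp

lemma fine_HK_partition_tag:
  assumes "fine_HK_partition T a b \<delta> n t \<xi>" "i \<in> {1..n}"
  shows "t (i - 1) < t i" "t (i - 1) \<in> T" "t i \<in> T" "\<xi> i \<in> {t (i - 1)..t i} \<inter> T"
    "a \<le> t (i - 1)" "t i \<le> b" "\<xi> i \<in> {a..b} \<inter> T"
    "{t (i - 1)..t i} \<inter> T \<subseteq> {\<xi> i - fst \<delta> (\<xi> i)..\<xi> i + snd \<delta> (\<xi> i)}"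
proof -
  show t: "t (i - 1) < t i" "t (i - 1) \<in> T" "t i \<in> T" "\<xi> i \<in> {t (i - 1)..t i} \<inter> T"
    "{t (i - 1)..t i} \<inter> T \<subseteq> {\<xi> i - fst \<delta> (\<xi> i)..\<xi> i + snd \<delta> (\<xi> i)}"
    using assms by (auto simp: fine_HK_partition_iff)
  show "a \<le> t (i - 1)" "t i \<le> b"
    using fine_HK_partition_mono[OF assms(1), of 0 "i - 1"]
      fine_HK_partition_mono[OF assms(1), of i n] assms
    by (auto simp: fine_HK_partition_iff)
  with t show "\<xi> i \<in> {a..b} \<inter> T" by auto
qed

lemma fine_HK_partition_length:
  assumes "fine_HK_partition T a b \<delta> n t \<xi>"
  shows "(\<Sum>i=1..n. t i - t (i - 1)) = b - a"
  using sum_telescope''[of 0 n t] assms by (simp add: fine_HK_partition_iff)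

text \<open>A fine partition is represented by the functional that maps an integrand to its
  Riemann sum; concatenation of partitions becomes addition of functionals.\<close>

definition fine_sum ::
  "real set \<Rightarrow> (real \<Rightarrow> real) \<times> (real \<Rightarrow> real) \<Rightarrow> real \<Rightarrow> real \<Rightarrow>
   ((real \<Rightarrow> 'x::real_vector) \<Rightarrow> 'x) \<Rightarrow> bool" where
  "fine_sum T \<delta> c d s \<longleftrightarrow>
     (\<exists>n t \<xi>. fine_HK_partition T c d \<delta> n t \<xi> \<and> s = (\<lambda>f. HK_sum f n t \<xi>))"

section \<open>Concatenation, comparison and refinement of fine sums\<close>

lemma fine_sum_empty: "c \<in> T \<Longrightarrow> fine_sum T \<delta> c c (\<lambda>f. 0)"
  unfolding fine_sum_def
  by (rule exI[of _ 0], rule exI[of _ "\<lambda>_. c"])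
    (auto simp: fine_HK_partition_iff HK_sum_def)

lemma fine_sum_single:
  assumes "c < d" "c \<in> T" "d \<in> T" "\<xi> \<in> {c..d} \<inter> T"
    and "{c..d} \<inter> T \<subseteq> {\<xi> - fst \<delta> \<xi>..\<xi> + snd \<delta> \<xi>}"
  shows "fine_sum T \<delta> c d (\<lambda>f. (d - c) *\<^sub>R f \<xi>)"
  unfolding fine_sum_def
  by (rule exI[of _ 1], rule exI[of _ "\<lambda>i. if i = 0 then c else d"], rule exI[of _ "\<lambda>_. \<xi>"])
    (use assms in \<open>auto simp: fine_HK_partition_iff HK_sum_def\<close>)

lemma fine_sum_append:
  assumes "fine_sum T \<delta> c e s" "fine_sum T \<delta> e d s'"
  shows "fine_sum T \<delta> c d (\<lambda>f. s f + s' f)"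
proof -
  obtain m t \<xi> where P: "fine_HK_partition T c e \<delta> m t \<xi>" and s: "s = (\<lambda>f. HK_sum f m t \<xi>)"
    using assms(1) by (auto simp: fine_sum_def)
  obtain n t' \<xi>' where P': "fine_HK_partition T e d \<delta> n t' \<xi>'" and s': "s' = (\<lambda>f. HK_sum f n t' \<xi>')"
    using assms(2) by (auto simp: fine_sum_def)
  \<comment> \<open>At the junction \<open>t m = t' 0\<close>, so \<open>u m\<close> also serves as
    the left end point of the first interval of the second partition.\<close>
  define u where "u i = (if i \<le> m then t i else t' (i - m))" for i
  define \<zeta> where "\<zeta> i = (if i \<le> m then \<xi> i else \<xi>' (i - m))" for i
  have u1: "u i = t i" "\<zeta> i = \<xi> i" "u (i - 1) = t (i - 1)" if "i \<in> {1..m}" for i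
    using that by (auto simp: u_def \<zeta>_def)
  have u2: "u (i + m) = t' i" "\<zeta> (i + m) = \<xi>' i" "u (i + m - 1) = t' (i - 1)" if "i \<in> {1..n}" for i
  proof -
    show "u (i + m) = t' i" "\<zeta> (i + m) = \<xi>' i"
      using that by (auto simp: u_def \<zeta>_def)
    have "t m = t' 0"
      using P P' by (simp add: fine_HK_partition_iff)
    then show "u (i + m - 1) = t' (i - 1)"
      using that by (cases "i = 1") (auto simp: u_def)
  qed
  have "fine_HK_partition T c d \<delta> (m + n) u \<zeta>"
    unfolding fine_HK_partition_iff
  proof (intro conjI ballI)
    show "u 0 = c" "u (m + n) = d"
      using P P' by (auto simp: u_def fine_HK_partition_iff)
    show "u i \<in> T" if "i \<in> {0..m + n}" for i
      using P P' that by (auto simp: u_def fine_HK_partition_iff)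
    fix i assume i: "i \<in> {1..m + n}"
    have "u (i - 1) < u i \<and> \<zeta> i \<in> {u (i - 1)..u i} \<inter> T \<and>
        {u (i - 1)..u i} \<inter> T \<subseteq> {\<zeta> i - fst \<delta> (\<zeta> i)..\<zeta> i + snd \<delta> (\<zeta> i)}"
    proof (cases "i \<le> m")
      case True
      then show ?thesis
        using i u1[of i] fine_HK_partition_tag[OF P, of i] by auto
    next
      case False
      then have "i - m \<in> {1..n}" "i - m + m = i" using i by auto
      then show ?thesis
        using u2[of "i - m"] fine_HK_partition_tag[OF P', of "i - m"] by auto
    qed
    then show "u (i - 1) < u i" "\<zeta> i \<in> {u (i - 1)..u i} \<inter> T"
      "{u (i - 1)..u i} \<inter> T \<subseteq> {\<zeta> i - fst \<delta> (\<zeta> i)..\<zeta> i + snd \<delta> (\<zeta> i)}" by blast+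
  qed
  moreover have "HK_sum f (m + n) u \<zeta> = s f + s' f" for f
  proof -
    let ?F = "\<lambda>i. (u i - u (i - 1)) *\<^sub>R f (\<zeta> i)"
    have "HK_sum f (m + n) u \<zeta> = (\<Sum>i=1..m. ?F i) + (\<Sum>i=1+m..n+m. ?F i)"
      unfolding HK_sum_def using sum.ub_add_nat[of 1 m ?F n] by (simp add: add.commute)
    also have "(\<Sum>i=1+m..n+m. ?F i) = (\<Sum>i=1..n. ?F (i + m))"
      by (rule sum.shift_bounds_cl_nat_ivl)
    also have "\<dots> = s' f"
      unfolding s' HK_sum_def by (intro sum.cong refl) (use u2 in force)
    also have "(\<Sum>i=1..m. ?F i) = s f"
      unfolding s HK_sum_def by (intro sum.cong refl) (use u1 in force)
    finally show ?thesis .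
  qed
  ultimately show ?thesis
    unfolding fine_sum_def by (intro exI[of _ "m + n"] exI[of _ u] exI[of _ \<zeta>]) auto
qed

lemma fine_sum_concat:
  fixes t :: "nat \<Rightarrow> real"
  assumes "t 0 \<in> T" "\<And>i. i \<in> {1..n} \<Longrightarrow> fine_sum T \<delta> (t (i - 1)) (t i) (s i)"
  shows "fine_sum T \<delta> (t 0) (t n) (\<lambda>f. \<Sum>i=1..n. s i f)"
  using assms(2)
proof (induction n)
  case 0
  then show ?case using fine_sum_empty[OF assms(1)] by simp
next
  case (Suc n)
  have "fine_sum T \<delta> (t 0) (t n) (\<lambda>f. \<Sum>i=1..n. s i f)"
    using Suc by simp
  from fine_sum_append[OF this, of "t (Suc n)" "s (Suc n)"] show ?case
    using Suc.prems[of "Suc n"] by simp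
qed

lemma fine_sum_mono:
  fixes f g :: "real \<Rightarrow> 'x::ordered_real_vector"
  assumes "fine_sum T \<delta> c d s" "\<And>t. t \<in> {c..d} \<inter> T \<Longrightarrow> f t \<le> g t"
  shows "s f \<le> s g"
proof -
  obtain n t \<xi> where P: "fine_HK_partition T c d \<delta> n t \<xi>" and s: "s = (\<lambda>f. HK_sum f n t \<xi>)"
    using assms(1) by (auto simp: fine_sum_def)
  have "(t i - t (i - 1)) *\<^sub>R f (\<xi> i) \<le> (t i - t (i - 1)) *\<^sub>R g (\<xi> i)" if "i \<in> {1..n}" for i
    using fine_HK_partition_tag[OF P that] assms(2)[of "\<xi> i"] by (intro scaleR_left_mono) auto
  then show ?thesis
    unfolding s HK_sum_def by (intro sum_mono) auto
qed

lemma fine_sum_const: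
  assumes "fine_sum T \<delta> c d s"
  shows "s (\<lambda>_. k) = (d - c) *\<^sub>R k"
proof -
  obtain n t \<xi> where P: "fine_HK_partition T c d \<delta> n t \<xi>" and s: "s = (\<lambda>f. HK_sum f n t \<xi>)"
    using assms(1) by (auto simp: fine_sum_def)
  show ?thesis
    unfolding s HK_sum_def fine_HK_partition_length[OF P, symmetric]
    by (rule scaleR_left.sum[symmetric])
qed

lemma fine_sum_gauge_mono:
  assumes "fine_sum T \<delta>' c d s"
    and "\<And>\<xi>. fst \<delta>' \<xi> \<le> fst \<delta> \<xi>" "\<And>\<xi>. snd \<delta>' \<xi> \<le> snd \<delta> \<xi>"
  shows "fine_sum T \<delta> c d s"
proof -
  obtain n t \<xi> where P: "fine_HK_partition T c d \<delta>' n t \<xi>" and s: "s = (\<lambda>f. HK_sum f n t \<xi>)"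
    using assms(1) by (auto simp: fine_sum_def)
  have "{\<xi> i - fst \<delta>' (\<xi> i)..\<xi> i + snd \<delta>' (\<xi> i)} \<subseteq> {\<xi> i - fst \<delta> (\<xi> i)..\<xi> i + snd \<delta> (\<xi> i)}" for i
    using assms(2,3)[of "\<xi> i"] by auto
  then have "fine_HK_partition T c d \<delta> n t \<xi>"
    using P unfolding fine_HK_partition_iff by (meson order_trans)
  with s show ?thesis by (auto simp: fine_sum_def)
qed

text \<open>A minimum of finitely many gauges stays positive and above the graininess. It yields
  partitions that are fine for several gauges at once.\<close>

lemma delta_gauge_Min:
  fixes \<delta> :: "nat \<Rightarrow> (real \<Rightarrow> real) \<times> (real \<Rightarrow> real)"
  assumes "\<And>k. delta_gauge T a b (\<delta> k)"
  obtains \<delta>' where "delta_gauge T a b \<delta>'"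
    and "\<And>k \<xi>. k \<le> K \<Longrightarrow> fst \<delta>' \<xi> \<le> fst (\<delta> k) \<xi>" "\<And>k \<xi>. k \<le> K \<Longrightarrow> snd \<delta>' \<xi> \<le> snd (\<delta> k) \<xi>"
proof
  let ?d = "(\<lambda>\<xi>. Min ((\<lambda>k. fst (\<delta> k) \<xi>) ` {..K}), \<lambda>\<xi>. Min ((\<lambda>k. snd (\<delta> k) \<xi>) ` {..K}))"
  show "delta_gauge T a b ?d"
    using assms by (auto simp: delta_gauge_iff)
qed auto

text \<open>Cousin's lemma. The condition \<open>\<delta>\<^sub>R \<ge> \<mu>\<close> lets a partition jump over the gap to the right
  of a right-scattered point.\<close>

lemma fine_sum_exists:
  fixes \<delta> :: "(real \<Rightarrow> real) \<times> (real \<Rightarrow> real)"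
  assumes T: "closed T" and \<delta>: "delta_gauge T a b \<delta>"
    and cd: "c \<in> T" "d \<in> T" "a \<le> c" "c \<le> d" "d \<le> b"
  shows "\<exists>s :: (real \<Rightarrow> 'x::real_vector) \<Rightarrow> 'x. fine_sum T \<delta> c d s"
proof -
  \<comment> \<open>\<open>S\<close> holds the points that a fine partition starting at
    \<open>c\<close> can reach. Its supremum \<open>z\<close> is shown to be reached and then to
    equal \<open>d\<close>.\<close>
  define S where "S = {x \<in> T \<inter> {c..d}. \<exists>s :: (real \<Rightarrow> 'x) \<Rightarrow> 'x. fine_sum T \<delta> c x s}"
  define z where "z = Sup S"
  have bdd: "bdd_above S"
    by (rule bdd_aboveI[of _ d]) (auto simp: S_def)
  have cS: "c \<in> S"
    using cd fine_sum_empty[of c T \<delta>] by (auto simp: S_def)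
  have "z \<in> closure S"
    unfolding z_def using cS bdd by (intro closure_contains_Sup) auto
  moreover have "closure S \<subseteq> T \<inter> {c..d}"
    using T by (intro closure_minimal closed_Int) (auto simp: S_def)
  ultimately have zT: "z \<in> T" "c \<le> z" "z \<le> d" by auto
  \<comment> \<open>A point \<open>x\<close> of \<open>S\<close> within the left gauge of
    \<open>z\<close> exists, and the interval from \<open>x\<close> to \<open>z\<close> can be added
    with tag \<open>z\<close>.\<close>
  have zS: "z \<in> S"
  proof (cases "z = c")
    case False
    then have "fst \<delta> z > 0"
      using \<delta> zT cd by (auto simp: delta_gauge_iff)
    then have "z - fst \<delta> z < Sup S" by (simp add: z_def)
    then obtain x where x: "x \<in> S" "z - fst \<delta> z < x"
      using less_cSup_iff[OF _ bdd] cS by blast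
    have "x \<le> z" unfolding z_def using x bdd by (intro cSup_upper)
    obtain s :: "(real \<Rightarrow> 'x) \<Rightarrow> 'x" where s: "fine_sum T \<delta> c x s"
      using x by (auto simp: S_def)
    show ?thesis
    proof (cases "x = z")
      case False
      have "0 \<le> snd \<delta> z"
        using \<delta> zT cd by (cases "z = b") (auto simp: delta_gauge_iff intro: less_imp_le)
      then have "fine_sum T \<delta> x z (\<lambda>f :: real \<Rightarrow> 'x. (z - x) *\<^sub>R f z)"
        using False \<open>x \<le> z\<close> x zT by (intro fine_sum_single) (auto simp: S_def)
      from fine_sum_append[OF s this] show ?thesis
        using zT unfolding S_def by auto
    qed (use x in simp)
  qed (use cS in simp)
  have "z = d"
  proof (rule ccontr)
    assume "z \<noteq> d"
    then have zd: "z < d" using zT by simp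
    then have R: "snd \<delta> z > 0" "graininess T z \<le> snd \<delta> z"
      using \<delta> zT cd by (auto simp: delta_gauge_iff)
    let ?A = "{x \<in> T. x > z}"
    have "Inf ?A \<le> z + snd \<delta> z"
      using R zd cd by (auto simp: graininess_def forward_jump_def split: if_splits)
    have A: "bdd_below ?A" "?A \<noteq> {}"
      using zd cd by (auto intro: bdd_belowI[of _ z])
    \<comment> \<open>At a right-scattered \<open>z\<close> the jump point \<open>Inf ?A\<close>
      belongs to \<open>T\<close> and lies within the right gauge. Otherwise points of
      \<open>T\<close> accumulate at \<open>z\<close> from the right, and one of them is close
      enough.\<close>
    have "\<exists>y\<in>T. z < y \<and> y \<le> z + snd \<delta> z \<and> y \<le> d"
    proof (cases "Inf ?A > z")
      case True
      have "Inf ?A \<in> closure ?A"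
        using A by (intro closure_contains_Inf)
      also have "closure ?A \<subseteq> T"
        using T by (intro closure_minimal) auto
      finally have "Inf ?A \<in> T" .
      moreover have "Inf ?A \<le> d"
        using A zd cd by (intro cInf_lower) auto
      ultimately show ?thesis
        using True \<open>Inf ?A \<le> z + snd \<delta> z\<close> by blast
    next
      case False
      then have "Inf ?A < min (z + snd \<delta> z) d"
        using R zd by auto
      then obtain y where "y \<in> ?A" "y < min (z + snd \<delta> z) d"
        using cInf_less_iff[OF A(2,1)] by blast
      then show ?thesis by (intro bexI[of _ y]) auto
    qed
    then obtain y where y: "y \<in> T" "z < y" "y \<le> z + snd \<delta> z" "y \<le> d" by blast
    obtain s :: "(real \<Rightarrow> 'x) \<Rightarrow> 'x" where s: "fine_sum T \<delta> c z s"
      using zS by (auto simp: S_def)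
    have "0 \<le> fst \<delta> z"
      using \<delta> zT cd by (cases "z = a") (auto simp: delta_gauge_iff intro: less_imp_le)
    then have "fine_sum T \<delta> z y (\<lambda>f :: real \<Rightarrow> 'x. (y - z) *\<^sub>R f z)"
      using y zT by (intro fine_sum_single) auto
    from fine_sum_append[OF s this] have "y \<in> S"
      using y zT unfolding S_def by auto
    then have "y \<le> z" unfolding z_def using bdd by (intro cSup_upper)
    with y show False by simp
  qed
  with zS show ?thesis by (auto simp: S_def)
qed

section \<open>The integral\<close>

lemma has_HK_delta_integral_iff:
  "has_HK_delta_integral T a b f x \<longleftrightarrow>
     (\<exists>r. D_sequence r \<and> (\<forall>\<phi>::nat \<Rightarrow> nat. \<exists>\<delta>. delta_gauge T a b \<delta> \<and>
        (\<forall>s. fine_sum T \<delta> a b s \<longrightarrow> \<bar>s f - x\<bar> < (SUP i. r i (\<phi> i)))))"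
proof -
  have "(\<forall>s. fine_sum T \<delta> a b s \<longrightarrow> \<bar>s f - x\<bar> < y) \<longleftrightarrow>
      (\<forall>n t \<xi>. fine_HK_partition T a b \<delta> n t \<xi> \<longrightarrow> \<bar>HK_sum f n t \<xi> - x\<bar> < y)" for \<delta> y
    by (auto simp: fine_sum_def)
  then show ?thesis
    unfolding has_HK_delta_integral_def by simp
qed

text \<open>Cousin's lemma supplies one partition that is fine for the gauges of both functions.
  Comparing its two Riemann sums leaves two regulator errors, which weak distributivity
  removes.\<close>

lemma has_HK_delta_integral_mono:
  fixes f g :: "real \<Rightarrow> 'x::dedekind_complete_riesz_space"
  assumes wsd: "weakly_sigma_distributive TYPE('x)"
    and T: "closed T" "a \<in> T" "b \<in> T" "a \<le> b"
    and f: "has_HK_delta_integral T a b f x" and g: "has_HK_delta_integral T a b g y"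
    and fg: "\<And>t. t \<in> {a..b} \<inter> T \<Longrightarrow> f t \<le> g t"
  shows "x \<le> y"
proof -
  obtain p where p: "D_sequence p" and fp: "\<And>\<phi>::nat \<Rightarrow> nat. \<exists>\<delta>. delta_gauge T a b \<delta> \<and>
      (\<forall>s. fine_sum T \<delta> a b s \<longrightarrow> \<bar>s f - x\<bar> < (SUP i. p i (\<phi> i)))"
    using f unfolding has_HK_delta_integral_iff by blast
  obtain q where q: "D_sequence q" and gq: "\<And>\<phi>::nat \<Rightarrow> nat. \<exists>\<delta>. delta_gauge T a b \<delta> \<and>
      (\<forall>s. fine_sum T \<delta> a b s \<longrightarrow> \<bar>s g - y\<bar> < (SUP i. q i (\<phi> i)))"
    using g unfolding has_HK_delta_integral_iff by blast
  have "x - y \<le> (SUP i. p i (\<phi> i)) + (SUP i. q i (\<phi> i))" for \<phi>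
  proof -
    obtain \<delta>1 where 1: "delta_gauge T a b \<delta>1"
      "\<And>s. fine_sum T \<delta>1 a b s \<Longrightarrow> \<bar>s f - x\<bar> < (SUP i. p i (\<phi> i))"
      using fp[of \<phi>] by blast
    obtain \<delta>2 where 2: "delta_gauge T a b \<delta>2"
      "\<And>s. fine_sum T \<delta>2 a b s \<Longrightarrow> \<bar>s g - y\<bar> < (SUP i. q i (\<phi> i))"
      using gq[of \<phi>] by blast
    define \<delta>0 where "\<delta>0 k = (if k = (0::nat) then \<delta>1 else \<delta>2)" for k
    have "delta_gauge T a b (\<delta>0 k)" for k
      using 1(1) 2(1) by (simp add: \<delta>0_def)
    then obtain \<delta> where \<delta>: "delta_gauge T a b \<delta>"
      "\<And>k \<xi>. k \<le> 1 \<Longrightarrow> fst \<delta> \<xi> \<le> fst (\<delta>0 k) \<xi>"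
      "\<And>k \<xi>. k \<le> 1 \<Longrightarrow> snd \<delta> \<xi> \<le> snd (\<delta>0 k) \<xi>"
      using delta_gauge_Min[of T a b \<delta>0 1] by metis
    obtain s :: "(real \<Rightarrow> 'x) \<Rightarrow> 'x" where s: "fine_sum T \<delta> a b s"
      using fine_sum_exists[OF T(1) \<delta>(1)] T by blast
    have s1: "fine_sum T \<delta>1 a b s"
      using \<delta>(2,3)[of 0] by (intro fine_sum_gauge_mono[OF s]) (auto simp: \<delta>0_def)
    have s2: "fine_sum T \<delta>2 a b s"
      using \<delta>(2,3)[of 1] by (intro fine_sum_gauge_mono[OF s]) (auto simp: \<delta>0_def)
    have "x \<le> s f + (SUP i. p i (\<phi> i))"
      by (rule abs_diff_leD(2)[OF less_imp_le[OF 1(2)[OF s1]]])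
    also have "\<dots> \<le> s g + (SUP i. p i (\<phi> i))"
      using fine_sum_mono[OF s fg] by simp
    also have "\<dots> \<le> (y + (SUP i. q i (\<phi> i))) + (SUP i. p i (\<phi> i))"
      using abs_diff_leD(1)[OF less_imp_le[OF 2(2)[OF s2]]] by simp
    finally show ?thesis by (simp add: algebra_simps)
  qed
  then have "x - y \<le> 0"
    by (rule weakly_sigma_distributive_le_zero2[OF wsd p q])
  then show ?thesis by simp
qed

text \<open>Every Riemann sum of the constant \<open>k\<close> equals
  \<open>(b - a) *\<^sub>R k\<close>, so the comparison is made on Riemann sums. In the main proof
  this bounds the sequence of integrals.\<close>

lemma has_HK_delta_integral_le_const:
  fixes f :: "real \<Rightarrow> 'x::dedekind_complete_riesz_space"
  assumes wsd: "weakly_sigma_distributive TYPE('x)"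
    and T: "closed T" "a \<in> T" "b \<in> T" "a \<le> b"
    and f: "has_HK_delta_integral T a b f x"
    and k: "\<And>t. t \<in> {a..b} \<inter> T \<Longrightarrow> f t \<le> k"
  shows "x \<le> (b - a) *\<^sub>R k"
proof -
  obtain p where p: "D_sequence p" and fp: "\<And>\<phi>::nat \<Rightarrow> nat. \<exists>\<delta>. delta_gauge T a b \<delta> \<and>
      (\<forall>s. fine_sum T \<delta> a b s \<longrightarrow> \<bar>s f - x\<bar> < (SUP i. p i (\<phi> i)))"
    using f unfolding has_HK_delta_integral_iff by blast
  have "x - (b - a) *\<^sub>R k \<le> (SUP i. p i (\<phi> i))" for \<phi>
  proof -
    obtain \<delta> where \<delta>: "delta_gauge T a b \<delta>"
      "\<And>s. fine_sum T \<delta> a b s \<Longrightarrow> \<bar>s f - x\<bar> < (SUP i. p i (\<phi> i))"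
      using fp[of \<phi>] by blast
    obtain s :: "(real \<Rightarrow> 'x) \<Rightarrow> 'x" where s: "fine_sum T \<delta> a b s"
      using fine_sum_exists[OF T(1) \<delta>(1)] T by blast
    have "x \<le> s f + (SUP i. p i (\<phi> i))"
      by (rule abs_diff_leD(2)[OF less_imp_le[OF \<delta>(2)[OF s]]])
    also have "\<dots> \<le> s (\<lambda>_. k) + (SUP i. p i (\<phi> i))"
      using fine_sum_mono[OF s, of f "\<lambda>_. k"] k by simp
    finally show ?thesis
      by (simp add: fine_sum_const[OF s] algebra_simps)
  qed
  then have "x - (b - a) *\<^sub>R k \<le> 0"
    by (rule weakly_sigma_distributive_le_zero[OF wsd p])
  then show ?thesis by simp
qed

text \<open>Uniqueness follows from monotonicity applied to \<open>f \<le> f\<close> in both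
  directions.\<close>

lemma HK_delta_integral_eq:
  fixes f :: "real \<Rightarrow> 'x::dedekind_complete_riesz_space"
  assumes "weakly_sigma_distributive TYPE('x)" "closed T" "a \<in> T" "b \<in> T" "a \<le> b"
    and "has_HK_delta_integral T a b f x"
  shows "HK_delta_integral T a b f = x"
  unfolding HK_delta_integral_def
proof (rule the_equality)
  fix y assume y: "has_HK_delta_integral T a b f y"
  show "y = x"
    by (rule antisym) (rule has_HK_delta_integral_mono[OF assms(1-5)], use y assms(6) in auto)+
qed (rule assms(6))

text \<open>A substitute for Henstock's lemma that needs no integrals over subintervals: every
  interval of the given partition is subdivided by a partition that is fine for all the gauges
  involved, and each \<open>f k\<close> is tested on two partitions of \<open>{a..b}\<close> that differ only in the
  intervals whose tag has level \<open>k\<close>.\<close>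

lemma mixed_level_sum:
  fixes f :: "nat \<Rightarrow> real \<Rightarrow> 'x::riesz_space"
    and \<delta> :: "nat \<Rightarrow> (real \<Rightarrow> real) \<times> (real \<Rightarrow> real)" and \<nu> :: "real \<Rightarrow> nat"
  assumes T: "closed T" and \<delta>: "\<And>k. delta_gauge T a b (\<delta> k)"
    and fine: "\<And>k s. fine_sum T (\<delta> k) a b s \<Longrightarrow> \<bar>s (f k) - x k\<bar> \<le> \<epsilon> k"
    and \<epsilon>: "\<And>k. 0 \<le> \<epsilon> k"
    and mono: "\<And>k m t. k \<le> m \<Longrightarrow> t \<in> {a..b} \<inter> T \<Longrightarrow> f k t \<le> f m t"
    and P: "fine_HK_partition T a b (\<lambda>\<xi>. fst (\<delta> (\<nu> \<xi>)) \<xi>, \<lambda>\<xi>. snd (\<delta> (\<nu> \<xi>)) \<xi>) n t \<xi>"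
    and N: "\<And>i. i \<in> {1..n} \<Longrightarrow> N \<le> \<nu> (\<xi> i)" and K: "\<And>i. i \<in> {1..n} \<Longrightarrow> \<nu> (\<xi> i) \<le> K"
    and "N \<le> K"
  defines "h \<equiv> \<Sum>i=1..n. (t i - t (i - 1)) *\<^sub>R f (\<nu> (\<xi> i)) (\<xi> i)"
    and "E \<equiv> \<Sum>k\<le>K. \<epsilon> k"
  shows "h \<le> x K + 3 *\<^sub>R E" "x N \<le> h + 3 *\<^sub>R E"
proof -
  note tag = fine_HK_partition_tag[OF P]
  have t0: "t 0 = a" "t n = b" "t 0 \<in> T"
    using P by (auto simp: fine_HK_partition_iff)
  obtain \<delta>' where \<delta>': "delta_gauge T a b \<delta>'"
    "\<And>k \<xi>. k \<le> K \<Longrightarrow> fst \<delta>' \<xi> \<le> fst (\<delta> k) \<xi>" "\<And>k \<xi>. k \<le> K \<Longrightarrow> snd \<delta>' \<xi> \<le> snd (\<delta> k) \<xi>"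
    using delta_gauge_Min[of T a b \<delta> K] \<delta> by metis
  have "\<exists>s :: (real \<Rightarrow> 'x) \<Rightarrow> 'x. fine_sum T \<delta>' (t (i - 1)) (t i) s" if "i \<in> {1..n}" for i
    using tag[OF that] by (intro fine_sum_exists[OF T \<delta>'(1)]) auto
  then obtain s :: "nat \<Rightarrow> (real \<Rightarrow> 'x) \<Rightarrow> 'x"
    where s: "\<And>i. i \<in> {1..n} \<Longrightarrow> fine_sum T \<delta>' (t (i - 1)) (t i) (s i)"
    by metis
  have sk: "fine_sum T (\<delta> k) (t (i - 1)) (t i) (s i)" if "i \<in> {1..n}" "k \<le> K" for i k
    using fine_sum_gauge_mono[OF s[OF that(1)]] \<delta>'(2,3)[OF that(2)] by blast
  have S: "\<bar>(\<Sum>i=1..n. s i (f k)) - x k\<bar> \<le> \<epsilon> k" if "k \<le> K" for k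
    using fine_sum_concat[of t T n "\<delta> k" s] sk t0 that fine by auto
  \<comment> \<open>Intervals of level \<open>k\<close> are kept whole with their original tag,
    which is fine for \<open>\<delta> k\<close> by the choice of the gauge; all others are replaced
    by their subdivision. The difference from the full subdivision isolates level
    \<open>k\<close>.\<close>
  define r where "r k i = (if \<nu> (\<xi> i) = k then \<lambda>f. (t i - t (i - 1)) *\<^sub>R f (\<xi> i) else s i)" for k i
  have "fine_sum T (\<delta> k) (t (i - 1)) (t i) (r k i)" if "i \<in> {1..n}" "k \<le> K" for i k
  proof (cases "\<nu> (\<xi> i) = k")
    case True
    then have "fine_sum T (\<delta> k) (t (i - 1)) (t i) (\<lambda>f :: real \<Rightarrow> 'x. (t i - t (i - 1)) *\<^sub>R f (\<xi> i))"
      using tag[OF that(1)] by (intro fine_sum_single) auto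
    then show ?thesis using True by (simp add: r_def)
  qed (use sk that in \<open>simp add: r_def\<close>)
  then have R: "\<bar>(\<Sum>i=1..n. r k i (f k)) - x k\<bar> \<le> \<epsilon> k" if "k \<le> K" for k
    using fine_sum_concat[of t T n "\<delta> k" "r k"] t0 that fine by auto
  \<comment> \<open>\<open>m\<close> uses the same level on each interval as \<open>h\<close> does,
    but sums over the subdivision.\<close>
  define m where "m = (\<Sum>i=1..n. s i (f (\<nu> (\<xi> i))))"
  have diff: "\<bar>\<Sum>i=1..n. r k i (f k) - s i (f k)\<bar> \<le> 2 *\<^sub>R \<epsilon> k" if "k \<le> K" for k
  proof -
    have "\<bar>((\<Sum>i=1..n. r k i (f k)) - x k) - ((\<Sum>i=1..n. s i (f k)) - x k)\<bar> \<le> \<epsilon> k + \<epsilon> k"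
      using abs_triangle_ineq4 add_mono[OF R[OF that] S[OF that]] order_trans by blast
    then show ?thesis by (simp add: sum_subtractf scaleR_2)
  qed
  \<comment> \<open>In the sum over \<open>k\<close> every interval contributes only at its own
    level, so exchanging the sums groups the differences by level.\<close>
  have "h - m = (\<Sum>i=1..n. \<Sum>k\<le>K. r k i (f k) - s i (f k))"
    unfolding h_def m_def sum_subtractf[symmetric]
  proof (rule sum.cong[OF refl])
    fix i assume i: "i \<in> {1..n}"
    have "(\<Sum>k\<le>K. r k i (f k) - s i (f k)) =
        (\<Sum>k\<le>K. if k = \<nu> (\<xi> i) then (t i - t (i - 1)) *\<^sub>R f (\<nu> (\<xi> i)) (\<xi> i) - s i (f (\<nu> (\<xi> i))) else 0)"
      by (rule sum.cong) (auto simp: r_def)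
    then show "(t i - t (i - 1)) *\<^sub>R f (\<nu> (\<xi> i)) (\<xi> i) - s i (f (\<nu> (\<xi> i))) =
        (\<Sum>k\<le>K. r k i (f k) - s i (f k))"
      using K[OF i] by simp
  qed
  also have "\<dots> = (\<Sum>k\<le>K. \<Sum>i=1..n. r k i (f k) - s i (f k))"
    by (rule sum.swap)
  finally have "\<bar>h - m\<bar> \<le> (\<Sum>k\<le>K. \<bar>\<Sum>i=1..n. r k i (f k) - s i (f k)\<bar>)"
    using sum_abs by simp
  also have "\<dots> \<le> (\<Sum>k\<le>K. 2 *\<^sub>R \<epsilon> k)"
    using diff by (intro sum_mono) auto
  also have "\<dots> = 2 *\<^sub>R E"
    unfolding E_def by (rule scaleR_right.sum[symmetric])
  finally have hm: "\<bar>h - m\<bar> \<le> 2 *\<^sub>R E" .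
  have eE: "\<epsilon> k \<le> E" if "k \<le> K" for k
    unfolding E_def using sum_mono2[of "{..K}" "{k}" \<epsilon>] that \<epsilon> by simp
  \<comment> \<open>Two copies of \<open>E\<close> come from comparing \<open>h\<close> with
    \<open>m\<close>, the third from comparing \<open>m\<close> with \<open>x K\<close> or
    \<open>x N\<close>; the latter works because the \<open>f k\<close> increase with
    \<open>k\<close>.\<close>
  have E3: "3 *\<^sub>R E = E + 2 *\<^sub>R E"
    using scaleR_add_left[of 1 2 E] by simp
  have sm: "s i (f k) \<le> s i (f l)" if "i \<in> {1..n}" "k \<le> l" for i k l
    using fine_sum_mono[OF s[OF that(1)], of "f k" "f l"] mono[OF that(2)] tag[OF that(1)] by auto
  have "m \<le> (\<Sum>i=1..n. s i (f K))"
    unfolding m_def using sm K by (intro sum_mono) auto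
  also have "\<dots> \<le> x K + E"
    using abs_diff_leD(1)[OF S[of K]] eE[of K] by (meson add_left_mono order_refl order_trans)
  finally have "h \<le> (x K + E) + 2 *\<^sub>R E"
    using abs_diff_leD(1)[OF hm] add_right_mono order_trans by blast
  then show "h \<le> x K + 3 *\<^sub>R E"
    by (simp add: E3 add.assoc)
  have "x N \<le> (\<Sum>i=1..n. s i (f N)) + E"
    using abs_diff_leD(2)[OF S[OF \<open>N \<le> K\<close>]] eE[OF \<open>N \<le> K\<close>] by (meson add_left_mono order_trans)
  also have "\<dots> \<le> m + E"
    unfolding m_def using sm N by (intro add_right_mono sum_mono) auto
  also have "\<dots> \<le> (h + 2 *\<^sub>R E) + E"
    using abs_diff_leD(2)[OF hm] by (rule add_right_mono)
  finally show "x N \<le> h + 3 *\<^sub>R E"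
    by (simp add: E3 algebra_simps)
qed

section \<open>Monotone convergence: the supremum of the integrals is the integral of the
  limit\<close>

theorem theorem4p5:
  fixes T :: "real set" and a b :: real
    and f :: "nat \<Rightarrow> real \<Rightarrow> 'x::dedekind_complete_riesz_space"
    and g :: "real \<Rightarrow> 'x"
  assumes "weakly_sigma_distributive TYPE('x)"
    and "time_scale T" and "a \<in> T" and "b \<in> T" and "a < b"
    and "\<And>n. HK_delta_integrable T a b (f n)"
    and "\<exists>l. \<forall>t\<in>{a..b} \<inter> T. l \<le> f 0 t"
    and "\<exists>l L. \<forall>t\<in>{a..b} \<inter> T. l \<le> g t \<and> g t \<le> L"
    and "\<And>n t. t \<in> {a..b} \<inter> T \<Longrightarrow> f n t \<le> f (Suc n) t"
    and "converges_common_regulator ({a..b} \<inter> T) f g"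
  shows "HK_delta_integrable T a b g \<and>
         D_convergent_to (\<lambda>n. HK_delta_integral T a b (f n)) (HK_delta_integral T a b g)"
proof -
  let ?I = "{a..b} \<inter> T"
  have T: "closed T" "a \<in> T" "b \<in> T" "a \<le> b" and aI: "a \<in> ?I"
    using assms(2-5) by (auto simp: time_scale_def)
  note wsd = assms(1)
  obtain A where A: "D_sequence A" and conv:
    "\<And>(\<phi>::nat \<Rightarrow> nat) t. t \<in> ?I \<Longrightarrow> \<exists>p. \<forall>n\<ge>p. \<bar>f n t - g t\<bar> < (SUP i. A i (\<phi> i))"
    using assms(10) unfolding converges_common_regulator_def by blast
  have conv': "\<exists>p. \<forall>n\<ge>p. f n t \<le> g t + (SUP i. A i (\<phi> i)) \<and> g t \<le> f n t + (SUP i. A i (\<phi> i))"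
    if "t \<in> ?I" for \<phi> :: "nat \<Rightarrow> nat" and t
    using conv[OF that, of \<phi>] by (meson abs_diff_leD less_imp_le)
  \<comment> \<open>This is the error along the zero sequence. The strict inequality at the point
    \<open>a\<close> forces \<open>0 < e\<close>, as \<open>strict_regulator\<close> requires;
    monotonicity in \<open>n\<close> also gives \<open>f n \<le> g + e\<close>, so the integrals are
    bounded above.\<close>
  define e where "e = (SUP i. A i 0)"
  obtain p where "\<bar>f p a - g a\<bar> < e"
    using conv[OF aI, of "\<lambda>_. 0"] unfolding e_def by blast
  then have e: "0 < e"
    using abs_ge_zero[of "f p a - g a"] by (rule order.strict_trans1[rotated])
  obtain l L where lL: "\<And>t. t \<in> ?I \<Longrightarrow> l \<le> g t \<and> g t \<le> L"
    using assms(8) by blast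
  define w where "w = \<bar>l\<bar> + \<bar>L\<bar>"
  have "- l \<le> w"
    unfolding w_def using abs_ge_minus_self[of l] by (rule order_trans) simp
  then have lw: "- w \<le> l" by (subst minus_le_iff)
  have "L \<le> w"
    unfolding w_def using abs_ge_self[of L] by (rule order_trans) simp
  with lw lL have gw: "- w \<le> g t" "g t \<le> w" if "t \<in> ?I" for t
    using that order_trans by blast+
  have w0: "0 \<le> w" unfolding w_def by simp
  have mono: "f k t \<le> f m t" if "k \<le> m" "t \<in> ?I" for k m t
    using that(1) by (rule lift_Suc_mono_le[of "\<lambda>n. f n t", rotated]) (rule assms(9)[OF that(2)])
  have fle: "f n t \<le> w + e" if t: "t \<in> ?I" for n t
  proof -
    obtain p where "\<forall>n\<ge>p. f n t \<le> g t + e"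
      using conv'[OF t, of "\<lambda>_. 0"] unfolding e_def by blast
    then have "f (max n p) t \<le> g t + e" by simp
    also have "\<dots> \<le> w + e" using gw[OF t] by simp
    finally show ?thesis
      using mono[OF max.cobounded1 t] order_trans by blast
  qed
  define x where "x n = HK_delta_integral T a b (f n)" for n
  have x: "has_HK_delta_integral T a b (f n) (x n)" for n
    using assms(6)[of n] HK_delta_integral_eq[OF wsd T]
    unfolding HK_delta_integrable_def x_def by metis
  define X where "X = (SUP n. x n)"
  have "x n \<le> (b - a) *\<^sub>R (w + e)" for n
    using fle by (intro has_HK_delta_integral_le_const[OF wsd T x])
  then have bdd: "bdd_above (range x)"
    by (intro bdd_aboveI[of _ "(b - a) *\<^sub>R (w + e)"]) auto
  have xX: "x n \<le> X" for n
    unfolding X_def by (rule cSUP_upper[OF _ bdd]) simp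
  have xmono: "x k \<le> x m" if "k \<le> m" for k m
    using mono[OF that] by (intro has_HK_delta_integral_mono[OF wsd T x x])
  have oX: "o_sequence (\<lambda>j. X - x j)"
    unfolding o_sequence_iff
  proof (intro conjI allI impI)
    show "antimono (\<lambda>j. X - x j)"
      using xmono by (auto simp: antimono_def)
    show "0 \<le> X - x j" for j
      using xX by simp
    fix z assume "\<forall>j. z \<le> X - x j"
    then have "x j \<le> X - z" for j by (simp add: algebra_simps)
    then have "X \<le> X - z"
      unfolding X_def by (intro cSUP_least) auto
    then show "z \<le> 0" by simp
  qed
  have "\<exists>r. \<forall>k. D_sequence (r k) \<and> (\<forall>\<phi>::nat \<Rightarrow> nat. \<exists>\<delta>. delta_gauge T a b \<delta> \<and>
      (\<forall>s. fine_sum T \<delta> a b s \<longrightarrow> \<bar>s (f k) - x k\<bar> < (SUP i. r k i (\<phi> i))))"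
    using x unfolding has_HK_delta_integral_iff by (intro choice) blast
  then obtain r where r: "\<And>k. D_sequence (r k)" and gauge:
    "\<And>k (\<phi>::nat \<Rightarrow> nat). \<exists>\<delta>. delta_gauge T a b \<delta> \<and>
      (\<forall>s. fine_sum T \<delta> a b s \<longrightarrow> \<bar>s (f k) - x k\<bar> < (SUP i. r k i (\<phi> i)))"
    by blast
  \<comment> \<open>One family collects all errors: index 0 for replacing \<open>g\<close> by
    \<open>f (\<nu> \<xi>)\<close>, index 1 for the distance from \<open>x N\<close> to
    \<open>X\<close>, and index \<open>k + 2\<close> for level \<open>k\<close> with the factor 3 of
    \<open>mixed_level_sum\<close>.\<close>
  define F where "F n = (if n = 0 then (\<lambda>i j. (b - a) *\<^sub>R A i j)
    else if n = 1 then (\<lambda>i j. X - x j) else (\<lambda>i j. 3 *\<^sub>R r (n - 2) i j))" for n :: nat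
  have F: "D_sequence (F n)" for n
    using D_sequence_scaleR[OF A, of "b - a"] D_sequence_row[OF oX] D_sequence_scaleR[OF r, of 3] T
    by (simp add: F_def)
  \<comment> \<open>\<open>u\<close> bounds the distance of every Riemann sum of \<open>g\<close>
    from \<open>X\<close>, so the truncation in Fremlin's lemma loses nothing.\<close>
  define u where "u = (b - a) *\<^sub>R w + \<bar>X\<bar>"
  have u: "0 \<le> u"
    unfolding u_def using w0 T by (intro add_nonneg_nonneg scaleR_nonneg_nonneg) auto
  obtain B where B: "D_sequence B" and
    FB: "\<And>\<phi> q. inf u (\<Sum>n\<le>q. SUP i. F n i (\<phi> (i + n))) \<le> (SUP i. B i (\<phi> i))"
    by (rule Fremlin[of F, OF F u]) (rule that)
  obtain C where C: "D_sequence C"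
    and BC: "\<And>\<phi> y. y \<le> (SUP i. B i (\<phi> i)) \<Longrightarrow> y < (SUP i. C i (\<phi> i))"
    by (rule strict_regulator[OF B e]) (rule that)
  have X: "has_HK_delta_integral T a b g X"
    unfolding has_HK_delta_integral_def
  proof (intro exI[of _ C] conjI allI C)
    fix \<phi> :: "nat \<Rightarrow> nat"
    define \<alpha> where "\<alpha> = (SUP i. A i (\<phi> i))"
    define \<epsilon> where "\<epsilon> k = (SUP i. r k i (\<phi> (i + (k + 2))))" for k
    have "\<exists>\<delta>. \<forall>k. delta_gauge T a b (\<delta> k) \<and>
        (\<forall>s. fine_sum T (\<delta> k) a b s \<longrightarrow> \<bar>s (f k) - x k\<bar> < \<epsilon> k)"
    proof (intro choice allI)
      show "\<exists>\<delta>. delta_gauge T a b \<delta> \<and> (\<forall>s. fine_sum T \<delta> a b s \<longrightarrow> \<bar>s (f k) - x k\<bar> < \<epsilon> k)" for k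
        unfolding \<epsilon>_def by (rule gauge)
    qed
    then obtain \<delta> where \<delta>: "\<And>k. delta_gauge T a b (\<delta> k)"
      and fine: "\<And>k s. fine_sum T (\<delta> k) a b s \<Longrightarrow> \<bar>s (f k) - x k\<bar> < \<epsilon> k" by blast
    have "\<exists>p. \<forall>t\<in>?I. \<forall>n\<ge>p t. f n t \<le> g t + \<alpha> \<and> g t \<le> f n t + \<alpha>"
      unfolding \<alpha>_def by (intro bchoice ballI conv')
    then obtain p
      where p: "\<And>t n. t \<in> ?I \<Longrightarrow> n \<ge> p t \<Longrightarrow> f n t \<le> g t + \<alpha> \<and> g t \<le> f n t + \<alpha>"
      by blast
    \<comment> \<open>Fremlin's lemma evaluates \<open>F 1\<close> at \<open>\<phi> (i + 1)\<close>;
      row 0 therefore controls \<open>X - x (\<phi> 1)\<close>.\<close>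
    define N where "N = \<phi> 1"
    define \<nu> where "\<nu> t = max N (p t)" for t
    let ?\<delta> = "(\<lambda>\<xi>. fst (\<delta> (\<nu> \<xi>)) \<xi>, \<lambda>\<xi>. snd (\<delta> (\<nu> \<xi>)) \<xi>)"
    have "\<bar>HK_sum g n t \<xi> - X\<bar> < (SUP i. C i (\<phi> i))"
      if P: "fine_HK_partition T a b ?\<delta> n t \<xi>" for n t \<xi>
    proof (rule BC)
      let ?\<Delta> = "\<lambda>i. t i - t (i - 1)"
      note tag = fine_HK_partition_tag[OF P]
      \<comment> \<open>A partition has finitely many tags, so a crude sum bounds all their levels
        and also \<open>N\<close>.\<close>
      define K where "K = N + (\<Sum>i=1..n. \<nu> (\<xi> i))"
      have K: "\<nu> (\<xi> i) \<le> K" if "i \<in> {1..n}" for i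
        using member_le_sum[OF that, of "\<lambda>i. \<nu> (\<xi> i)"] by (simp add: K_def)
      define h where "h = (\<Sum>i=1..n. ?\<Delta> i *\<^sub>R f (\<nu> (\<xi> i)) (\<xi> i))"
      define E where "E = 3 *\<^sub>R (\<Sum>k\<le>K. \<epsilon> k)"
      have \<epsilon>0: "0 \<le> \<epsilon> k" for k
        unfolding \<epsilon>_def using D_sequence_SUP_nonneg[OF r[of k], of "\<lambda>i. \<phi> (i + (k + 2))"] by simp
      have fine_le: "\<bar>s (f k) - x k\<bar> \<le> \<epsilon> k" if "fine_sum T (\<delta> k) a b s" for k s
        using fine[OF that] by (rule less_imp_le)
      have h: "h \<le> x K + E" "x N \<le> h + E"
        unfolding h_def E_def
        by (rule mixed_level_sum[where f = f and \<delta> = \<delta> and x = x and \<nu> = \<nu> and N = N];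
            (fact T(1) \<delta> fine_le \<epsilon>0 mono P K | simp add: \<nu>_def K_def))+
      have const: "(\<Sum>i=1..n. ?\<Delta> i *\<^sub>R \<alpha>) = (b - a) *\<^sub>R \<alpha>"
        unfolding fine_HK_partition_length[OF P, symmetric] by (rule scaleR_left.sum[symmetric])
      have "HK_sum g n t \<xi> \<le> (\<Sum>i=1..n. ?\<Delta> i *\<^sub>R (f (\<nu> (\<xi> i)) (\<xi> i) + \<alpha>))"
        unfolding HK_sum_def using p tag(1,7)
        by (intro sum_mono scaleR_left_mono) (auto simp: \<nu>_def less_imp_le)
      then have up: "HK_sum g n t \<xi> \<le> h + (b - a) *\<^sub>R \<alpha>"
        unfolding h_def const[symmetric] by (simp add: scaleR_add_right sum.distrib)
      have "h \<le> (\<Sum>i=1..n. ?\<Delta> i *\<^sub>R (g (\<xi> i) + \<alpha>))"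
        unfolding h_def using p tag(1,7)
        by (intro sum_mono scaleR_left_mono) (auto simp: \<nu>_def less_imp_le)
      then have low: "h \<le> HK_sum g n t \<xi> + (b - a) *\<^sub>R \<alpha>"
        unfolding HK_sum_def const[symmetric] by (simp add: scaleR_add_right sum.distrib)
      define D where "D = (\<Sum>m\<le>Suc (Suc K). SUP i. F m i (\<phi> (i + m)))"
      have D: "(b - a) *\<^sub>R \<alpha> + (X - x N) + E \<le> D"
      proof -
        have "(b - a) *\<^sub>R \<alpha> \<le> (SUP i. F 0 i (\<phi> (i + 0)))"
          unfolding \<alpha>_def F_def using scaleR_SUP_le[OF A, of "b - a" \<phi>] T by simp
        moreover have "X - x N \<le> (SUP i. F 1 i (\<phi> (i + 1)))"
          using D_sequence_upper[OF F[of 1], of 0 "\<lambda>i. \<phi> (i + 1)"] by (simp add: F_def N_def)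
        moreover have "E \<le> (\<Sum>k\<le>K. SUP i. F (Suc (Suc k)) i (\<phi> (i + Suc (Suc k))))"
          unfolding E_def scaleR_right.sum
        proof (rule sum_mono)
          show "3 *\<^sub>R \<epsilon> k \<le> (SUP i. F (Suc (Suc k)) i (\<phi> (i + Suc (Suc k))))" for k
            unfolding \<epsilon>_def F_def
            using scaleR_SUP_le[OF r[of k], of 3 "\<lambda>i. \<phi> (i + (k + 2))"] by simp
        qed
        ultimately have "(b - a) *\<^sub>R \<alpha> + ((X - x N) + E) \<le> D"
          unfolding D_def sum.atMost_Suc_shift by (intro add_mono) simp_all
        then show ?thesis by (simp add: add.assoc)
      qed
      \<comment> \<open>From above, \<open>x K \<le> X\<close> suffices; from below, the sum is
        compared with \<open>x N\<close>, at the cost of \<open>X - x N\<close>.\<close>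
      have "\<bar>HK_sum g n t \<xi> - X\<bar> \<le> (b - a) *\<^sub>R \<alpha> + (X - x N) + E"
      proof (rule abs_diff_leI)
        have "HK_sum g n t \<xi> \<le> (X + E) + (b - a) *\<^sub>R \<alpha>"
          using up h(1) xX[of K] by (meson add_right_mono order_trans)
        also have "\<dots> \<le> (X + E) + (b - a) *\<^sub>R \<alpha> + (X - x N)"
          using xX[of N] by simp
        finally show "HK_sum g n t \<xi> \<le> X + ((b - a) *\<^sub>R \<alpha> + (X - x N) + E)"
          by (simp add: algebra_simps)
        have "x N \<le> (HK_sum g n t \<xi> + (b - a) *\<^sub>R \<alpha>) + E"
          using low h(2) by (meson add_right_mono order_trans)
        then show "X \<le> HK_sum g n t \<xi> + ((b - a) *\<^sub>R \<alpha> + (X - x N) + E)"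
          by (simp add: algebra_simps)
      qed
      with D have "\<bar>HK_sum g n t \<xi> - X\<bar> \<le> D" by (rule order_trans[rotated])
      moreover have "\<bar>HK_sum g n t \<xi> - X\<bar> \<le> u"
      proof -
        have fs: "fine_sum T ?\<delta> a b (\<lambda>f :: real \<Rightarrow> 'x. HK_sum f n t \<xi>)"
          unfolding fine_sum_def using P by blast
        have "HK_sum g n t \<xi> \<le> (b - a) *\<^sub>R w"
          using fine_sum_mono[OF fs, of g "\<lambda>_. w"] gw by (simp add: fine_sum_const[OF fs])
        moreover have "- HK_sum g n t \<xi> \<le> (b - a) *\<^sub>R w"
          using fine_sum_mono[OF fs, of "\<lambda>_. - w" g] gw
          by (simp add: fine_sum_const[OF fs] minus_le_iff)
        ultimately have "\<bar>HK_sum g n t \<xi>\<bar> \<le> (b - a) *\<^sub>R w" by (rule abs_leI)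
        then show ?thesis
          unfolding u_def using abs_triangle_ineq4 add_right_mono order_trans by blast
      qed
      ultimately have "\<bar>HK_sum g n t \<xi> - X\<bar> \<le> inf u D" by simp
      then show "\<bar>HK_sum g n t \<xi> - X\<bar> \<le> (SUP i. B i (\<phi> i))"
        unfolding D_def using FB order_trans by blast
    qed
    moreover have "delta_gauge T a b ?\<delta>"
      using \<delta> by (auto simp: delta_gauge_iff)
    ultimately show "\<exists>\<delta>. delta_gauge T a b \<delta> \<and> (\<forall>n t \<xi>. fine_HK_partition T a b \<delta> n t \<xi> \<longrightarrow>
        \<bar>HK_sum g n t \<xi> - X\<bar> < (SUP i. C i (\<phi> i)))" by blast
  qed
  \<comment> \<open>With all rows equal to \<open>X - x j\<close>, row 0 shows that
    \<open>\<phi> 0\<close> can serve as the threshold.\<close>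
  have "D_convergent_to x X"
    unfolding D_convergent_to_def
  proof (intro exI[of _ "\<lambda>i j. X - x j"] conjI allI D_sequence_row oX)
    fix \<phi> :: "nat \<Rightarrow> nat"
    have "\<bar>x n - X\<bar> \<le> (SUP i. X - x (\<phi> i))" if "\<phi> 0 \<le> n" for n
    proof -
      have "\<bar>x n - X\<bar> = X - x n"
        using xX[of n] abs_of_nonpos[of "x n - X"] by simp
      also have "\<dots> \<le> X - x (\<phi> 0)"
        using xmono[OF that] by simp
      also have "\<dots> \<le> (SUP i. X - x (\<phi> i))"
        by (rule D_sequence_upper[OF D_sequence_row[OF oX], where i = 0])
      finally show ?thesis .
    qed
    then show "\<exists>n\<^sub>0. \<forall>n\<ge>n\<^sub>0. \<bar>x n - X\<bar> \<le> (SUP i. X - x (\<phi> i))" by blast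
  qed
  then show ?thesis
    using X HK_delta_integral_eq[OF wsd T X] unfolding x_def HK_delta_integrable_def by auto
qed

end
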